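(* Let $\mathcal O$ be a non-empty subset of $\mathbb Z\setminus\{0\}$. The following assertions are equivalent: (i) The prediction error matrix $\Delta(\mathcal O)$ is invertible. (ii) The elements $x_1(0),\ldots,x_n(0)$ of $X(0)$ are linearly independent over $H(\mathcal O)$, i.e. for $a_1,\ldots,a_n\in\mathbb C$, $\sum_{j=1}^na_jx_j(0)\in H(\mathcal O)$ implies $a_1=\ldots=a_n=0$. (iii) All Rozanov distances $\tilde d_k(\mathcal O)$, $k\in\{1,\ldots,n\}$, are positive.
   Context: $K$ is a complex Hilbert space with inner product $(\cdot,\cdot)$ and norm $\|\cdot\|$. $\mathbf X=(X(s))_{s\in\mathbb Z}$, $X(s)=(x_1(s),\ldots,x_n(s))^\top\in K^n$, is an $n$-variate (weakly) stationary sequence, i.e. $(x_j(s+h),x_k(u+h))=(x_j(s),x_k(u))$ for all $s,u,h\in\mathbb Z$ and $j,k\in\{1,\ldots,n\}$. $H(\mathcal O)$ is the closed linear hull in $K$ of $\{x_j(s):j\in\{1,\ldots,n\},\ s\in\mathcal O\}$, and $P$ is the orthogonal projection onto $H(\mathcal O)$. The prediction error matrix is the $n\times n$ Gram matrix $\Delta(\mathcal O)=\big((x_j(0)-Px_j(0),\,x_k(0)-Px_k(0))\big)_{j,k=1}^n$. The Rozanov distances are $\tilde d_k(\mathcal O)=\inf\{\|x_k(0)-y\|^2:y\in H(\mathcal O)+\mathrm{span}\{x_j(0):j\neq k\}\}$, $k\in\{1,\ldots,n\}$. *)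

theory Defs
  imports "HOL-Analysis.Analysis"
begin

(* The inner product is linear in its first argument. Norm, metric, topology and completeness
   are those of the class banach, tied to the inner product by norm_eq_sqrt_cinner. *)
class complex_hilbert_space = banach +
  fixes scaleC :: "complex \<Rightarrow> 'a \<Rightarrow> 'a" (infixr "*\<^sub>C" 75)
    and cinner :: "'a \<Rightarrow> 'a \<Rightarrow> complex"
  assumes scaleC_add_right: "a *\<^sub>C (x + y) = a *\<^sub>C x + a *\<^sub>C y"
    and scaleC_add_left: "(a + b) *\<^sub>C x = a *\<^sub>C x + b *\<^sub>C x"
    and scaleC_scaleC: "a *\<^sub>C b *\<^sub>C x = (a * b) *\<^sub>C x"
    and scaleC_one: "1 *\<^sub>C x = x"
    and scaleR_scaleC: "r *\<^sub>R x = complex_of_real r *\<^sub>C x"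
    and cinner_commute: "cinner x y = cnj (cinner y x)"
    and cinner_add_left: "cinner (x + y) z = cinner x z + cinner y z"
    and cinner_scaleC_left: "cinner (a *\<^sub>C x) y = a * cinner x y"
    and cinner_ge_zero: "0 \<le> Re (cinner x x)"
    and cinner_eq_zero_iff: "cinner x x = 0 \<longleftrightarrow> x = 0"
    and norm_eq_sqrt_cinner: "norm x = sqrt (Re (cinner x x))"

global_interpretation complex_vector: vector_space "scaleC :: complex \<Rightarrow> 'a \<Rightarrow> 'a::complex_hilbert_space"
  defines cspan_raw_def: cspan = complex_vector.span
  by unfold_locales (rule scaleC_add_right scaleC_add_left scaleC_scaleC scaleC_one)+

(* For a closed linear subspace M of a Hilbert space the described point exists and is unique. *)
definition orth_proj :: "'a::complex_hilbert_space set \<Rightarrow> 'a \<Rightarrow> 'a" where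
  "orth_proj M x = (THE p. p \<in> M \<and> (\<forall>y\<in>M. cinner (x - p) y = 0))"

(* X s $ j is the j-th component of X(s). *)
definition stationary :: "(int \<Rightarrow> 'a::complex_hilbert_space ^ 'n) \<Rightarrow> bool" where
  "stationary X \<longleftrightarrow>
     (\<forall>s u h j k. cinner (X (s + h) $ j) (X (u + h) $ k) = cinner (X s $ j) (X u $ k))"

definition observed_space :: "(int \<Rightarrow> 'a::complex_hilbert_space ^ 'n) \<Rightarrow> int set \<Rightarrow> 'a set" where
  "observed_space X \<O> = closure (cspan {X s $ j | s j. s \<in> \<O>})"

definition prediction_error_matrix ::
  "(int \<Rightarrow> 'a::complex_hilbert_space ^ 'n) \<Rightarrow> int set \<Rightarrow> complex ^ 'n ^ 'n" where
  "prediction_error_matrix X \<O> =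
     (let P = orth_proj (observed_space X \<O>)
      in \<chi> j k. cinner (X 0 $ j - P (X 0 $ j)) (X 0 $ k - P (X 0 $ k)))"

definition rozanov_distance ::
  "(int \<Rightarrow> 'a::complex_hilbert_space ^ 'n) \<Rightarrow> int set \<Rightarrow> 'n \<Rightarrow> real" where
  "rozanov_distance X \<O> k =
     Inf {(norm (X 0 $ k - (h + v)))\<^sup>2 | h v.
            h \<in> observed_space X \<O> \<and> v \<in> cspan {X 0 $ j | j. j \<noteq> k}}"

definition lin_indep_over :: "'a::complex_hilbert_space ^ 'n \<Rightarrow> 'a set \<Rightarrow> bool" where
  "lin_indep_over x M \<longleftrightarrow>
     (\<forall>a :: 'n \<Rightarrow> complex. (\<Sum>j\<in>UNIV. a j *\<^sub>C (x $ j)) \<in> M \<longrightarrow> (\<forall>j. a j = 0))"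

end

theory Submission
  imports Defs
begin

text \<open>
  Write \<open>M\<close> for the observed space, \<open>P\<close> for the projection onto it and
  \<open>e\<^sub>j = x\<^sub>j(0) - P x\<^sub>j(0)\<close> for the prediction errors, so that the prediction error matrix is the
  Gram matrix of the \<open>e\<^sub>j\<close>. The three assertions are linked in a cycle.

  If the Gram matrix is invertible, its inverse provides a family \<open>f\<^sub>k\<close> in the span of the errors
  that is dual to them, \<open>(f\<^sub>k, e\<^sub>j) = \<delta>\<^sub>k\<^sub>j\<close> (\<open>invertible_gram_dual_family\<close>). The \<open>f\<^sub>k\<close> are orthogonal
  to \<open>M\<close>, so \<open>(f\<^sub>k, x\<^sub>j(0)) = \<delta>\<^sub>k\<^sub>j\<close> as well. Hence \<open>f\<^sub>k\<close> has inner product 1 with every vector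
  \<open>x\<^sub>k(0) - (h + v)\<close> that competes in the Rozanov distance, and the Cauchy-Schwarz inequality bounds
  the norms of all these vectors below by the positive number \<open>1 / \<parallel>f\<^sub>k\<parallel>\<close>.

  If \<open>x\<^sub>1(0), \<dots>, x\<^sub>n(0)\<close> are linearly dependent over \<open>M\<close>, some \<open>x\<^sub>k(0)\<close> with a nonzero coefficient
  can be solved for, so it lies in \<open>M + span {x\<^sub>j(0) : j \<noteq> k}\<close> and its Rozanov distance vanishes.

  If the Gram matrix is singular, its rows are dependent, and a dependency of the rows is one of the
  errors themselves (\<open>singular_gram_dependent\<close>). With \<open>\<Sum> a\<^sub>j e\<^sub>j = 0\<close> the
  combination \<open>\<Sum> a\<^sub>j x\<^sub>j(0) = \<Sum> a\<^sub>j P x\<^sub>j(0)\<close> lies in \<open>M\<close>.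

  All of this rests on the existence of orthogonal projections onto closed subspaces, which is derived
  from the parallelogram law and completeness (\<open>closest_point_exists\<close>).
\<close>

section \<open>Complex inner products\<close>

lemma cinner_add_right: "cinner x (y + z) = cinner x y + cinner x z"
  by (metis cinner_add_left cinner_commute complex_cnj_add)

lemma cinner_scaleC_right: "cinner x (a *\<^sub>C y) = cnj a * cinner x y"
  by (metis cinner_commute cinner_scaleC_left complex_cnj_mult)

lemma cinner_zero_left [simp]: "cinner 0 y = 0"
  using cinner_add_left[of 0 0 y] by simp

lemma cinner_zero_right [simp]: "cinner x 0 = 0"
  using cinner_add_right[of x 0 0] by simp

lemma cinner_diff_left: "cinner (x - y) z = cinner x z - cinner y z"
  using cinner_add_left[of "x - y" y z] by simp

lemma cinner_diff_right: "cinner x (y - z) = cinner x y - cinner x z"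
  using cinner_add_right[of x "y - z" z] by simp

lemma cinner_sum_left: "cinner (\<Sum>i\<in>A. f i) y = (\<Sum>i\<in>A. cinner (f i) y)"
  by (induction A rule: infinite_finite_induct) (auto simp: cinner_add_left)

lemma cinner_sum_right: "cinner x (\<Sum>i\<in>A. f i) = (\<Sum>i\<in>A. cinner x (f i))"
  by (induction A rule: infinite_finite_induct) (auto simp: cinner_add_right)

lemma cinner_self_eq_norm: "cinner x x = complex_of_real ((norm x)\<^sup>2)"
proof (rule complex_eqI)
  have "Im (cinner x x) = - Im (cinner x x)"
    by (metis cinner_commute complex_cnj cnj.simps(2))
  then show "Im (cinner x x) = Im (complex_of_real ((norm x)\<^sup>2))"
    by simp
qed (simp add: norm_eq_sqrt_cinner cinner_ge_zero)

lemma norm_scaleC: "norm (a *\<^sub>C x) = cmod a * norm x"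
proof -
  have "complex_of_real ((norm (a *\<^sub>C x))\<^sup>2) = a * cnj a * cinner x x"
    unfolding cinner_self_eq_norm[symmetric] by (simp add: cinner_scaleC_left cinner_scaleC_right)
  also have "\<dots> = complex_of_real ((cmod a * norm x)\<^sup>2)"
    by (simp add: cinner_self_eq_norm power_mult_distrib flip: complex_norm_square)
  finally have "complex_of_real ((norm (a *\<^sub>C x))\<^sup>2) = complex_of_real ((cmod a * norm x)\<^sup>2)" .
  then show ?thesis
    by (simp only: of_real_eq_iff) (simp add: power2_eq_iff_nonneg)
qed

lemma parallelogram_law:
  fixes x y :: "'a::complex_hilbert_space"
  shows "(norm (x + y))\<^sup>2 + (norm (x - y))\<^sup>2 = 2 * (norm x)\<^sup>2 + 2 * (norm y)\<^sup>2"
proof -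
  have "complex_of_real ((norm (x + y))\<^sup>2 + (norm (x - y))\<^sup>2)
      = complex_of_real (2 * (norm x)\<^sup>2 + 2 * (norm y)\<^sup>2)"
    unfolding of_real_add of_real_mult cinner_self_eq_norm[symmetric]
    by (simp add: cinner_add_left cinner_add_right cinner_diff_left cinner_diff_right)
  then show ?thesis
    by (simp only: of_real_eq_iff)
qed

text \<open>
  The coefficient is the one that minimises the norm over the complex line through \<open>y\<close>. Nonnegativity
  of the left-hand side gives the Cauchy-Schwarz inequality; minimality of \<open>z\<close> itself forces \<open>z\<close> to
  be orthogonal to \<open>y\<close>.
\<close>

lemma norm_diff_component:
  fixes y z :: "'a::complex_hilbert_space"
  assumes "y \<noteq> 0"
  shows "(norm (z - (cinner z y / (norm y)\<^sup>2) *\<^sub>C y))\<^sup>2 = (norm z)\<^sup>2 - (cmod (cinner z y))\<^sup>2 / (norm y)\<^sup>2"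
proof -
  define n where "n = complex_of_real ((norm y)\<^sup>2)"
  define c where "c = cinner z y"
  have n: "n \<noteq> 0" "cinner y y = n" "cnj n = n"
    using assms by (simp_all add: n_def cinner_self_eq_norm)
  have c: "cinner z y = c" "cinner y z = cnj c"
    by (simp_all add: c_def flip: cinner_commute)
  have "complex_of_real ((norm (z - (c / n) *\<^sub>C y))\<^sup>2) = cinner z z - c * cnj c / n"
    unfolding cinner_self_eq_norm[symmetric]
    by (simp add: cinner_diff_left cinner_diff_right cinner_scaleC_left cinner_scaleC_right n c
        field_simps)
  also have "\<dots> = complex_of_real ((norm z)\<^sup>2 - (cmod c)\<^sup>2 / (norm y)\<^sup>2)"
    by (simp add: cinner_self_eq_norm n_def flip: complex_norm_square)
  finally show ?thesis
    unfolding c_def n_def by (simp only: of_real_eq_iff)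
qed

lemma cauchy_schwarz:
  fixes y z :: "'a::complex_hilbert_space"
  shows "cmod (cinner z y) \<le> norm z * norm y"
proof (cases "y = 0")
  case False
  then have "(cmod (cinner z y))\<^sup>2 / (norm y)\<^sup>2 \<le> (norm z)\<^sup>2"
    using norm_diff_component[OF False, of z] by (metis diff_ge_0_iff_ge zero_le_power2)
  then have "(cmod (cinner z y))\<^sup>2 \<le> (norm z * norm y)\<^sup>2"
    using False by (simp add: field_simps power_mult_distrib)
  then show ?thesis
    by (rule power2_le_imp_le) simp
qed simp

section \<open>Orthogonal projections\<close>

lemma closure_csubspace:
  assumes "complex_vector.subspace S"
  shows "complex_vector.subspace (closure S)"
proof (rule complex_vector.subspaceI)
  show "0 \<in> closure S"
    using assms closure_subset complex_vector.subspace_0 by blast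
next
  fix x y assume "x \<in> closure S" "y \<in> closure S"
  then obtain u v where "\<forall>n. u n \<in> S" "u \<longlonglongrightarrow> x" "\<forall>n. v n \<in> S" "v \<longlonglongrightarrow> y"
    by (auto simp: closure_sequential)
  then show "x + y \<in> closure S"
    unfolding closure_sequential
    by (intro exI[of _ "\<lambda>n. u n + v n"])
      (auto intro: tendsto_add complex_vector.subspace_add[OF assms])
next
  fix c x assume "x \<in> closure S"
  then obtain u where u: "\<forall>n. u n \<in> S" "u \<longlonglongrightarrow> x"
    by (auto simp: closure_sequential)
  have "(\<lambda>n. cmod c * norm (u n - x)) \<longlonglongrightarrow> 0"
    using u(2) by (intro tendsto_mult_right_zero tendsto_norm_zero LIM_zero)
  then have "(\<lambda>n. norm (c *\<^sub>C u n - c *\<^sub>C x)) \<longlonglongrightarrow> 0"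
    by (simp add: norm_scaleC flip: complex_vector.scale_right_diff_distrib)
  then have "(\<lambda>n. c *\<^sub>C u n) \<longlonglongrightarrow> c *\<^sub>C x"
    by (rule tendsto_norm_zero_cancel[THEN LIM_zero_cancel])
  then show "c *\<^sub>C x \<in> closure S"
    unfolding closure_sequential using u(1)
    by (intro exI[of _ "\<lambda>n. c *\<^sub>C u n"]) (auto intro: complex_vector.subspace_scale[OF assms])
qed

text \<open>
  By the parallelogram law two points of \<open>M\<close> that are nearly closest to \<open>x\<close> are close to each other,
  because their midpoint lies in \<open>M\<close> as well and is no closer to \<open>x\<close> than \<open>infdist x M\<close>. The sets of
  nearly closest points therefore shrink to a point, which exists by completeness.
\<close>

lemma closest_point_exists:
  fixes x :: "'a::complex_hilbert_space"
  assumes "convex M" "closed M" "M \<noteq> {}"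
  obtains p where "p \<in> M" "\<And>y. y \<in> M \<Longrightarrow> norm (x - p) \<le> norm (x - y)"
proof -
  define d where "d = infdist x M"
  have d_le: "d \<le> norm (x - y)" if "y \<in> M" for y
    using infdist_le[OF that, of x] by (simp add: d_def dist_norm)
  have d_nonneg: "0 \<le> d"
    by (simp add: d_def infdist_nonneg)
  define S where "S n = {y \<in> M. (norm (x - y))\<^sup>2 \<le> d\<^sup>2 + 1 / real (Suc n)}" for n
  have near: "(dist y z)\<^sup>2 \<le> 4 / real (Suc n)" if "y \<in> S n" "z \<in> S n" for y z n
  proof -
    have "(1/2) *\<^sub>R y + (1/2) *\<^sub>R z \<in> M"
      using that convexD[OF assms(1), of y z "1/2" "1/2"] by (simp add: S_def)
    moreover have "(x - y) + (x - z) = 2 *\<^sub>R (x - ((1/2) *\<^sub>R y + (1/2) *\<^sub>R z))"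
      by (simp add: algebra_simps scaleR_2)
    ultimately have "2 * d \<le> norm ((x - y) + (x - z))"
      using d_le by simp
    then have "(2 * d)\<^sup>2 \<le> (norm ((x - y) + (x - z)))\<^sup>2"
      using d_nonneg by (intro power_mono) auto
    moreover have "(x - y) - (x - z) = z - y"
      by simp
    ultimately have "(norm (z - y))\<^sup>2 \<le> 2 * (norm (x - y))\<^sup>2 + 2 * (norm (x - z))\<^sup>2 - 4 * d\<^sup>2"
      using parallelogram_law[of "x - y" "x - z"] by (simp add: power_mult_distrib)
    then show ?thesis
      using that by (simp add: S_def dist_norm norm_minus_commute)
  qed
  have "\<exists>p. \<forall>n. p \<in> S n"
  proof (rule decreasing_closed_nest[of S])
    fix n
    have "closed {y. (norm (x - y))\<^sup>2 \<le> d\<^sup>2 + 1 / real (Suc n)}"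
      by (intro closed_Collect_le continuous_intros)
    then show "closed (S n)"
      using assms(2) by (simp add: S_def Collect_conj_eq closed_Int)
    have "d < sqrt (d\<^sup>2 + 1 / real (Suc n))"
      by (rule real_less_rsqrt) simp
    then obtain y where "y \<in> M" "dist x y < sqrt (d\<^sup>2 + 1 / real (Suc n))"
      using cInf_lessD[of "dist x ` M"] assms(3) by (auto simp: d_def infdist_def)
    then have "y \<in> S n"
      using real_sqrt_less_iff[of "(dist x y)\<^sup>2"] by (simp add: S_def dist_norm)
    then show "S n \<noteq> {}"
      by blast
  next
    fix m n :: nat assume "m \<le> n"
    then have "1 / real (Suc n) \<le> 1 / real (Suc m)"
      by (simp add: frac_le)
    then show "S n \<subseteq> S m"
      by (auto simp: S_def)
  next
    fix \<epsilon> :: real assume "\<epsilon> > 0"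
    then obtain n where "inverse (real (Suc n)) < \<epsilon>\<^sup>2 / 4"
      using reals_Archimedean[of "\<epsilon>\<^sup>2 / 4"] by auto
    then have "4 / real (Suc n) < \<epsilon>\<^sup>2"
      by (simp add: field_simps)
    then show "\<exists>n. \<forall>y\<in>S n. \<forall>z\<in>S n. dist y z < \<epsilon>"
      using near \<open>\<epsilon> > 0\<close> by (meson less_imp_le order_le_less_trans power_less_imp_less_base)
  qed blast
  then obtain p where p: "\<And>n. p \<in> S n"
    by blast
  have "(norm (x - p))\<^sup>2 \<le> d\<^sup>2"
  proof (rule field_le_epsilon)
    fix e :: real assume "e > 0"
    then obtain n where "inverse (real (Suc n)) < e"
      using reals_Archimedean by blast
    then show "(norm (x - p))\<^sup>2 \<le> d\<^sup>2 + e"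
      using p[of n] by (simp add: S_def inverse_eq_divide)
  qed
  then have "norm (x - p) \<le> d"
    using d_nonneg by (rule power2_le_imp_le)
  show ?thesis
  proof
    show "p \<in> M"
      using p[of 0] by (simp add: S_def)
    show "norm (x - p) \<le> norm (x - y)" if "y \<in> M" for y
      using \<open>norm (x - p) \<le> d\<close> d_le[OF that] by simp
  qed
qed

lemma csubspace_imp_convex:
  assumes "complex_vector.subspace M"
  shows "convex M"
proof (rule convexI)
  fix x y and u v :: real
  assume "x \<in> M" "y \<in> M"
  then show "u *\<^sub>R x + v *\<^sub>R y \<in> M"
    unfolding scaleR_scaleC
    using assms complex_vector.subspace_add complex_vector.subspace_scale by blast
qed

text \<open>
  The closest point \<open>p\<close> works: a nonzero inner product of \<open>x - p\<close> with some \<open>y \<in> M\<close> would allow a move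
  from \<open>p\<close> along \<open>y\<close>, within \<open>M\<close>, to a point closer to \<open>x\<close>.
\<close>

lemma orthogonal_projection_exists:
  fixes x :: "'a::complex_hilbert_space"
  assumes M: "complex_vector.subspace M" "closed M"
  obtains p where "p \<in> M" "\<And>y. y \<in> M \<Longrightarrow> cinner (x - p) y = 0"
proof -
  have "M \<noteq> {}"
    using complex_vector.subspace_0[OF M(1)] by blast
  then obtain p where p: "p \<in> M" "\<And>y. y \<in> M \<Longrightarrow> norm (x - p) \<le> norm (x - y)"
    using closest_point_exists[OF csubspace_imp_convex[OF M(1)] M(2)] by blast
  have "cinner (x - p) y = 0" if "y \<in> M" for y
  proof (cases "y = 0")
    case False
    define t where "t = cinner (x - p) y / (norm y)\<^sup>2"
    have "p + t *\<^sub>C y \<in> M"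
      using complex_vector.subspace_add[OF M(1) p(1)] complex_vector.subspace_scale[OF M(1) that]
      by blast
    then have "(norm (x - p))\<^sup>2 \<le> (norm (x - p - t *\<^sub>C y))\<^sup>2"
      using p(2) by (intro power_mono) (auto simp: diff_diff_eq)
    then have "(cmod (cinner (x - p) y))\<^sup>2 / (norm y)\<^sup>2 \<le> 0"
      unfolding t_def norm_diff_component[OF False] by simp
    then show ?thesis
      using False by (simp add: divide_le_0_iff)
  qed simp
  with p(1) show ?thesis
    using that by blast
qed

text \<open>
  The definite description in the definition of \<open>orth_proj\<close> denotes a point only if that point is
  unique: the difference of two candidates lies in \<open>M\<close> and is orthogonal to \<open>M\<close>, hence to itself.
\<close>

lemma orth_proj_props:
  fixes x :: "'a::complex_hilbert_space"
  assumes M: "complex_vector.subspace M" "closed M"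
  shows orth_proj_in: "orth_proj M x \<in> M"
    and orth_proj_residual: "y \<in> M \<Longrightarrow> cinner (x - orth_proj M x) y = 0"
proof -
  let ?Q = "\<lambda>p. p \<in> M \<and> (\<forall>y\<in>M. cinner (x - p) y = 0)"
  obtain p where p: "?Q p"
    using orthogonal_projection_exists[OF M, of x] by metis
  have "q = p" if "?Q q" for q
  proof -
    have "q - p \<in> M"
      using that p by (intro complex_vector.subspace_diff[OF M(1)]) auto
    then have "cinner (x - p) (q - p) - cinner (x - q) (q - p) = 0"
      using that p by simp
    then have "cinner (q - p) (q - p) = 0"
      by (simp flip: cinner_diff_left)
    then show ?thesis
      by (simp add: cinner_eq_zero_iff)
  qed
  then have "?Q (orth_proj M x)"
    unfolding orth_proj_def using p by (intro theI[of ?Q p])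
  then show "orth_proj M x \<in> M" "y \<in> M \<Longrightarrow> cinner (x - orth_proj M x) y = 0"
    by auto
qed

section \<open>Gram matrices\<close>

text \<open>
  The rows of the inverse of the Gram matrix are the coefficients of the dual family: multiplying
  the Gram matrix from the left by \<open>B\<close> replaces the \<open>e\<^sub>i\<close> in the first argument of the inner product
  by their combinations with coefficients \<open>B\<^sub>k\<^sub>i\<close>.
\<close>

lemma invertible_gram_dual_family:
  fixes e :: "'n::finite \<Rightarrow> 'a::complex_hilbert_space"
  assumes "invertible (\<chi> j k. cinner (e j) (e k))"
  obtains f where "\<And>k. f k \<in> cspan (range e)"
    "\<And>k j. cinner (f k) (e j) = (if k = j then 1 else 0)"
proof -
  obtain B where B: "B ** (\<chi> j k. cinner (e j) (e k)) = mat 1"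
    using assms by (auto simp: invertible_left_inverse)
  define f where "f k = (\<Sum>i\<in>UNIV. (B $ k $ i) *\<^sub>C e i)" for k
  have "cinner (f k) (e j) = (B ** (\<chi> j k. cinner (e j) (e k))) $ k $ j" for k j
    by (simp add: f_def cinner_sum_left cinner_scaleC_left matrix_matrix_mult_def)
  then have "cinner (f k) (e j) = (if k = j then 1 else 0)" for k j
    by (simp add: B mat_def)
  moreover have "f k \<in> cspan (range e)" for k
    unfolding f_def
    by (intro complex_vector.span_sum complex_vector.span_scale complex_vector.span_base) auto
  ultimately show ?thesis
    using that by blast
qed

text \<open>
  A dependency \<open>a\<close> of the rows says that \<open>\<Sum> a\<^sub>i e\<^sub>i\<close> is orthogonal to every \<open>e\<^sub>j\<close>, hence to itself.
\<close>

lemma singular_gram_dependent: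
  fixes e :: "'n::finite \<Rightarrow> 'a::complex_hilbert_space"
  assumes "\<not> invertible (\<chi> j k. cinner (e j) (e k))"
  obtains a i where "a i \<noteq> 0" "(\<Sum>j\<in>UNIV. a j *\<^sub>C e j) = 0"
proof -
  let ?G = "\<chi> j k. cinner (e j) (e k)"
  obtain a i where a: "(\<Sum>j\<in>UNIV. a j *s row j ?G) = 0" "a i \<noteq> 0"
    using assms unfolding invertible_right_inverse matrix_right_invertible_independent_rows by blast
  define w where "w = (\<Sum>j\<in>UNIV. a j *\<^sub>C e j)"
  have "cinner w (e k) = (\<Sum>j\<in>UNIV. a j *s row j ?G) $ k" for k
    by (simp add: w_def cinner_sum_left cinner_scaleC_left row_def)
  then have "cinner w (e k) = 0" for k
    by (simp add: a(1))
  then have "cinner w w = 0"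
    by (subst (2) w_def) (simp add: cinner_sum_right cinner_scaleC_right)
  then show ?thesis
    using that[of a i] a(2) by (simp add: w_def cinner_eq_zero_iff)
qed

section \<open>Prediction errors and Rozanov distances\<close>

lemma csubspace_observed_space: "complex_vector.subspace (observed_space X \<O>)"
  unfolding observed_space_def by (intro closure_csubspace complex_vector.subspace_span)

lemma closed_observed_space: "closed (observed_space X \<O>)"
  by (simp add: observed_space_def)

lemma rozanov_distance_le:
  assumes "h \<in> observed_space X \<O>" "v \<in> cspan {X 0 $ j | j. j \<noteq> k}"
  shows "rozanov_distance X \<O> k \<le> (norm (X 0 $ k - (h + v)))\<^sup>2"
  unfolding rozanov_distance_def using assms
  by (intro cInf_lower bdd_belowI[of _ 0]) auto

lemma rozanov_distance_ge:
  assumes "\<And>h v. h \<in> observed_space X \<O> \<Longrightarrow> v \<in> cspan {X 0 $ j | j. j \<noteq> k} \<Longrightarrow>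
    c \<le> (norm (X 0 $ k - (h + v)))\<^sup>2"
  shows "c \<le> rozanov_distance X \<O> k"
proof -
  have "0 \<in> observed_space X \<O>" "0 \<in> cspan {X 0 $ j | j. j \<noteq> k}"
    by (auto intro: complex_vector.subspace_0 csubspace_observed_space complex_vector.span_zero)
  then show ?thesis
    unfolding rozanov_distance_def using assms by (intro cInf_greatest) auto
qed

lemma cinner_span_right_eq_0:
  assumes "v \<in> cspan S" "\<And>s. s \<in> S \<Longrightarrow> cinner f s = 0"
  shows "cinner f v = 0"
  using assms(1)
proof (induction rule: complex_vector.span_induct)
  case base
  show ?case
    by (rule complex_vector.subspaceI) (auto simp: cinner_add_right cinner_scaleC_right)
qed (rule assms(2))

lemma cinner_span_left_eq_0:
  assumes "v \<in> cspan S" "\<And>s. s \<in> S \<Longrightarrow> cinner s f = 0"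
  shows "cinner v f = 0"
  using cinner_span_right_eq_0[OF assms(1), of f] assms(2)
  by (metis cinner_commute complex_cnj_zero)

text \<open>
  A vector that is dual to \<open>x\<^sub>k(0)\<close> and orthogonal to both \<open>M\<close> and the other \<open>x\<^sub>j(0)\<close> separates \<open>x\<^sub>k(0)\<close>
  from \<open>M + span {x\<^sub>j(0) : j \<noteq> k}\<close> by a positive distance.
\<close>

lemma invertible_imp_rozanov_pos:
  fixes X :: "int \<Rightarrow> 'a::complex_hilbert_space ^ 'n"
  assumes "invertible (prediction_error_matrix X \<O>)"
  shows "0 < rozanov_distance X \<O> k"
proof -
  let ?M = "observed_space X \<O>"
  note M = csubspace_observed_space[of X \<O>] closed_observed_space[of X \<O>]
  define e where "e j = X 0 $ j - orth_proj ?M (X 0 $ j)" for j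
  have "invertible (\<chi> j k. cinner (e j) (e k))"
    using assms by (simp add: prediction_error_matrix_def Let_def e_def)
  then obtain f where f: "\<And>k. f k \<in> cspan (range e)"
    "\<And>k j. cinner (f k) (e j) = (if k = j then 1 else 0)"
    by (rule invertible_gram_dual_family) auto
  have f_M: "cinner (f k) h = 0" if "h \<in> ?M" for h
    using f(1) by (rule cinner_span_left_eq_0) (auto simp: e_def orth_proj_residual[OF M that])
  \<comment> \<open>Since \<open>x\<^sub>j(0)\<close> and \<open>e\<^sub>j\<close> differ by an element of \<open>M\<close>, duality carries over from \<open>e\<^sub>j\<close> to \<open>x\<^sub>j(0)\<close>.\<close>
  have f_X: "cinner (f k) (X 0 $ j) = (if k = j then 1 else 0)" for j
    using f(2)[of k j] f_M[OF orth_proj_in[OF M]] by (simp add: e_def cinner_diff_right)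
  have "f k \<noteq> 0"
    using f(2)[of k k] by auto
  have "(1 / norm (f k))\<^sup>2 \<le> (norm (X 0 $ k - (h + v)))\<^sup>2"
    if "h \<in> ?M" "v \<in> cspan {X 0 $ j | j. j \<noteq> k}" for h v
  proof -
    have "cinner (f k) v = 0"
      using that(2) by (rule cinner_span_right_eq_0) (auto simp: f_X)
    then have "cinner (f k) (X 0 $ k - (h + v)) = 1"
      by (simp add: cinner_diff_right cinner_add_right f_X f_M[OF that(1)])
    then have "1 \<le> norm (f k) * norm (X 0 $ k - (h + v))"
      using cauchy_schwarz[of "f k" "X 0 $ k - (h + v)"] by simp
    then have "1 / norm (f k) \<le> norm (X 0 $ k - (h + v))"
      using \<open>f k \<noteq> 0\<close> by (simp add: field_simps)
    then show ?thesis
      by (intro power_mono) auto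
  qed
  then have "(1 / norm (f k))\<^sup>2 \<le> rozanov_distance X \<O> k"
    by (rule rozanov_distance_ge)
  moreover have "0 < (1 / norm (f k))\<^sup>2"
    using \<open>f k \<noteq> 0\<close> by simp
  ultimately show ?thesis
    by linarith
qed

lemma rozanov_pos_imp_lin_indep_over:
  fixes X :: "int \<Rightarrow> 'a::complex_hilbert_space ^ 'n"
  assumes "\<And>k. 0 < rozanov_distance X \<O> k"
  shows "lin_indep_over (X 0) (observed_space X \<O>)"
  unfolding lin_indep_over_def
proof (intro allI impI, rule ccontr)
  fix a :: "'n \<Rightarrow> complex" and k
  let ?M = "observed_space X \<O>" and ?s = "\<Sum>j\<in>UNIV - {k}. a j *\<^sub>C (X 0 $ j)"
  assume in_M: "(\<Sum>j\<in>UNIV. a j *\<^sub>C (X 0 $ j)) \<in> ?M" and "a k \<noteq> 0"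
  \<comment> \<open>Solving the relation for \<open>x\<^sub>k(0)\<close> exhibits it as its own competitor, at distance zero.\<close>
  define h where "h = (1 / a k) *\<^sub>C (\<Sum>j\<in>UNIV. a j *\<^sub>C (X 0 $ j))"
  define v where "v = (- 1 / a k) *\<^sub>C ?s"
  have "h \<in> ?M"
    unfolding h_def using csubspace_observed_space in_M by (rule complex_vector.subspace_scale)
  moreover have "v \<in> cspan {X 0 $ j | j. j \<noteq> k}"
    unfolding v_def
    by (intro complex_vector.span_scale complex_vector.span_sum complex_vector.span_base) auto
  moreover have "h + v = X 0 $ k"
  proof -
    have "(\<Sum>j\<in>UNIV. a j *\<^sub>C (X 0 $ j)) = a k *\<^sub>C (X 0 $ k) + ?s"
      by (rule sum.remove) auto
    then show ?thesis
      using \<open>a k \<noteq> 0\<close>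
      by (simp add: h_def v_def scaleC_add_right scaleC_scaleC scaleC_one)
  qed
  ultimately have "rozanov_distance X \<O> k \<le> 0"
    using rozanov_distance_le[of h X \<O> v k] by simp
  then show False
    using assms[of k] by simp
qed

lemma lin_indep_over_imp_invertible:
  fixes X :: "int \<Rightarrow> 'a::complex_hilbert_space ^ 'n"
  assumes "lin_indep_over (X 0) (observed_space X \<O>)"
  shows "invertible (prediction_error_matrix X \<O>)"
proof (rule ccontr)
  let ?M = "observed_space X \<O>"
  note M = csubspace_observed_space[of X \<O>] closed_observed_space[of X \<O>]
  let ?P = "orth_proj ?M"
  assume "\<not> invertible (prediction_error_matrix X \<O>)"
  then have "\<not> invertible (\<chi> j k. cinner (X 0 $ j - ?P (X 0 $ j)) (X 0 $ k - ?P (X 0 $ k)))"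
    by (simp add: prediction_error_matrix_def Let_def)
  then obtain a i where a: "a i \<noteq> 0" "(\<Sum>j\<in>UNIV. a j *\<^sub>C (X 0 $ j - ?P (X 0 $ j))) = 0"
    by (rule singular_gram_dependent)
  then have "(\<Sum>j\<in>UNIV. a j *\<^sub>C (X 0 $ j)) = (\<Sum>j\<in>UNIV. a j *\<^sub>C ?P (X 0 $ j))"
    by (simp add: complex_vector.scale_right_diff_distrib sum_subtractf)
  also have "\<dots> \<in> ?M"
    by (intro complex_vector.subspace_sum complex_vector.subspace_scale M orth_proj_in)
  finally show False
    using assms a(1) by (auto simp: lin_indep_over_def)
qed

theorem proposition6p2:
  fixes X :: "int \<Rightarrow> 'a::complex_hilbert_space ^ 'n"
    and \<O> :: "int set"
  assumes "stationary X"
    and "\<O> \<noteq> {}"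
    and "\<O> \<subseteq> UNIV - {0}"
  shows "(invertible (prediction_error_matrix X \<O>)
            \<longleftrightarrow> lin_indep_over (X 0) (observed_space X \<O>))
       \<and> (lin_indep_over (X 0) (observed_space X \<O>)
            \<longleftrightarrow> (\<forall>k. 0 < rozanov_distance X \<O> k))"
  using invertible_imp_rozanov_pos rozanov_pos_imp_lin_indep_over lin_indep_over_imp_invertible
  by blast

end
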